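(* Consider the planar ad hoc sensor network with $(2n+1)^2$ sensors placed at the points $(ir,jr)$, $i,j\in\{-n,\dots,n\}$, with fixed spacing $r>0$ (fixed node density, infinite area model), a fixed SNR, a fusion center at $(0,0)$, minimum hop routing, energy per link $E_{link}(r)=r^{\delta}$, and per-sensor information $\mathcal{K}_s(\mathrm{SNR},r)$. Let $\eta=I_t/E_t$ be the energy efficiency, i.e. the ratio of the total gathered information to the total required energy. Then, as $n\to\infty$, i.e. as the covered area $(2nr)^2$ increases, the energy efficiency decays to zero with rate $$\eta=O\left(\mathrm{area}^{-1/2}\right).$$
   Context: Network model: the measurement of the sensor with index $(i,j)\in\{-n,\dots,n\}^2$ is delivered to the fusion center at the origin by minimum hop routing along the grid, using $|i|+|j|$ hops, each hop of length $r$ costing energy $E_{link}(r)=r^\delta$, where $\delta\ge 2$ is a constant propagation loss factor. The total required energy is $E_t=E_{link}(r)\sum_{i=-n}^{n}\sum_{j=-n}^{n}(|i|+|j|)$. The total gathered information is $I_t=(2n+1)^2\,\mathcal{K}_s(\mathrm{SNR},r)$, the number of sensors times the information per sensor. Information per sensor: for $\mathrm{SNR}>0$ and edge dependence factor $\zeta\in[0,1/4)$, $$\mathcal{K}_s(\mathrm{SNR},\zeta)=\frac{1}{4\pi^2}\int_{-\pi}^{\pi}\int_{-\pi}^{\pi}\left(\frac12\log(1+q)+\frac12\frac{1}{1+q}-\frac12\right)d\omega_1 d\omega_2,\quad q=\frac{\mathrm{SNR}}{(2/\pi)K(4\zeta)(1-2\zeta\cos\omega_1-2\zeta\cos\omega_2)},$$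 with $K(k)=\int_0^{\pi/2}(1-k^2\sin^2\theta)^{-1/2}d\theta$, and $\mathcal{K}_s(\mathrm{SNR},1/4)=0$. The spacing determines $\zeta$ by $\zeta=g(f(r))$, where $f:(0,\infty)\to[0,1]$ is a positive, monotonically decreasing function (giving the edge correlation factor $\rho=f(r)$) and $g:[0,1]\to[0,1/4]$ is monotone with $g(0)=0$ and $g(1)=1/4$; one writes $\mathcal{K}_s(\mathrm{SNR},r)=\mathcal{K}_s(\mathrm{SNR},g(f(r)))$. *)

theory Defs
  imports "HOL-Analysis.Analysis" "HOL-Library.Landau_Symbols"
begin

definition complete_elliptic_K :: "real \<Rightarrow> real" where
  "complete_elliptic_K k = integral {0..pi/2} (\<lambda>\<theta>. (1 - k\<^sup>2 * (sin \<theta>)\<^sup>2) powr (- (1/2)))"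

definition spectral_snr :: "real \<Rightarrow> real \<Rightarrow> real \<Rightarrow> real \<Rightarrow> real" where
  "spectral_snr SNR \<zeta> \<omega>\<^sub>1 \<omega>\<^sub>2 =
     SNR / ((2 / pi) * complete_elliptic_K (4 * \<zeta>) * (1 - 2 * \<zeta> * cos \<omega>\<^sub>1 - 2 * \<zeta> * cos \<omega>\<^sub>2))"

text \<open>
  Only edge dependence factors in the interval from 0 to 1/4 are meaningful. The endpoint 1/4,
  where the elliptic integral diverges, has value 0 by convention. Information is measured in
  nats.
\<close>

definition information_per_sensor :: "real \<Rightarrow> real \<Rightarrow> real" where
  "information_per_sensor SNR \<zeta> =
     (if \<zeta> = 1/4 then 0
      else 1 / (4 * pi\<^sup>2) *
        integral {-pi..pi} (\<lambda>\<omega>\<^sub>1. integral {-pi..pi} (\<lambda>\<omega>\<^sub>2.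
          let q = spectral_snr SNR \<zeta> \<omega>\<^sub>1 \<omega>\<^sub>2
          in 1/2 * ln (1 + q) + 1/2 * (1 / (1 + q)) - 1/2)))"

definition information_at_spacing ::
    "(real \<Rightarrow> real) \<Rightarrow> (real \<Rightarrow> real) \<Rightarrow> real \<Rightarrow> real \<Rightarrow> real" where
  "information_at_spacing f g SNR r = information_per_sensor SNR (g (f r))"

definition link_energy :: "real \<Rightarrow> real \<Rightarrow> real" where
  "link_energy \<delta> r = r powr \<delta>"

text \<open>Length of a shortest path along the grid from the sensor with index (i, j) to the origin.\<close>

definition hop_count :: "int \<Rightarrow> int \<Rightarrow> int" where
  "hop_count i j = \<bar>i\<bar> + \<bar>j\<bar>"

definition total_energy :: "real \<Rightarrow> real \<Rightarrow> nat \<Rightarrow> real" where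
  "total_energy \<delta> r n =
     link_energy \<delta> r * (\<Sum>i = - int n..int n. \<Sum>j = - int n..int n. real_of_int (hop_count i j))"

definition total_information ::
    "(real \<Rightarrow> real) \<Rightarrow> (real \<Rightarrow> real) \<Rightarrow> real \<Rightarrow> real \<Rightarrow> nat \<Rightarrow> real" where
  "total_information f g SNR r n = (2 * real n + 1)\<^sup>2 * information_at_spacing f g SNR r"

definition energy_efficiency ::
    "(real \<Rightarrow> real) \<Rightarrow> (real \<Rightarrow> real) \<Rightarrow> real \<Rightarrow> real \<Rightarrow> real \<Rightarrow> nat \<Rightarrow> real" where
  "energy_efficiency f g SNR \<delta> r n = total_information f g SNR r n / total_energy \<delta> r n"

definition covered_area :: "real \<Rightarrow> nat \<Rightarrow> real" where
  "covered_area r n = (2 * real n * r)\<^sup>2"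

end

theory Submission
  imports Defs
begin

text \<open>With \<open>r\<close> fixed, the information per sensor and the energy per link are
  constants in \<open>n\<close>, so only counting matters. There are \<open>(2n+1)^2\<close>
  sensors, while the hops total \<open>2n(n+1)(2n+1)\<close>, of cubic order, because a typical
  sensor is about \<open>n\<close> hops away. One factor \<open>2n+1\<close> cancels
  (\<open>energy_efficiency_eq\<close>), leaving a constant times \<open>(2n+1)/(n(n+1))\<close>,
  hence order \<open>1/n\<close> (\<open>energy_efficiency_bigo_inverse\<close>). The side of the
  covered square is \<open>2nr\<close>, so area to the power \<open>-1/2\<close> is also of order
  \<open>1/n\<close>.\<close>

lemma sum_abs_symmetric_interval:
  "(\<Sum>i = - int n..int n. real_of_int \<bar>i\<bar>) = real n * (real n + 1)"
proof (induction n)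
  case 0
  show ?case by simp
next
  case (Suc n)
  have "{- int (Suc n)..int (Suc n)} = {- int n - 1, int n + 1} \<union> {- int n..int n}"
    by auto
  then have "(\<Sum>i = - int (Suc n)..int (Suc n). real_of_int \<bar>i\<bar>)
      = 2 * (real n + 1) + (\<Sum>i = - int n..int n. real_of_int \<bar>i\<bar>)"
    by simp
  with Suc show ?case by (simp add: algebra_simps)
qed

text \<open>The hop count is a sum of one term per coordinate; by symmetry each coordinate
  contributes \<open>2n+1\<close> copies of the one-dimensional sum \<open>n(n+1)\<close>.\<close>

lemma total_energy_eq:
  "total_energy \<delta> r n = r powr \<delta> * (2 * (2 * real n + 1) * real n * (real n + 1))"
proof -
  have "(\<Sum>i = - int n..int n. \<Sum>j = - int n..int n. real_of_int (hop_count i j))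
      = 2 * ((2 * real n + 1) * (real n * (real n + 1)))"
    unfolding hop_count_def of_int_add sum.distrib sum_constant sum_abs_symmetric_interval
      sum_distrib_left[symmetric]
    by simp
  then show ?thesis
    by (simp add: total_energy_def link_energy_def)
qed

text \<open>Positivity of \<open>r\<close> removes the absolute value from the root of the square.
  At \<open>n = 0\<close> both sides are 0, by the conventions for \<open>0 powr x\<close> and
  \<open>1 / 0\<close>.\<close>

lemma covered_area_powr_neg_half:
  assumes "r > 0"
  shows "covered_area r n powr (- (1/2)) = 1 / (2 * real n * r)"
proof -
  have "covered_area r n powr (- (1/2)) = inverse (sqrt ((2 * real n * r)\<^sup>2))"
    unfolding covered_area_def powr_minus by (subst powr_half_sqrt) simp_all
  also have "sqrt ((2 * real n * r)\<^sup>2) = 2 * real n * r"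
    using assms by (subst real_sqrt_abs) simp
  finally show ?thesis by (simp only: inverse_eq_divide)
qed

lemma energy_efficiency_eq:
  "energy_efficiency f g SNR \<delta> r n = information_at_spacing f g SNR r / (2 * r powr \<delta>)
     * ((2 * real n + 1) / (real n * (real n + 1)))"
proof -
  define m where "m = 2 * real n + 1"
  \<comment> \<open>Only the cancelled factor must be nonzero: if another factor of the denominator
    vanishes, as at \<open>n = 0\<close>, both sides are 0.\<close>
  have "m \<noteq> 0" unfolding m_def by linarith
  then show ?thesis
    unfolding energy_efficiency_def total_information_def total_energy_eq m_def[symmetric]
    by (simp add: power2_eq_square mult_ac)
qed

lemma energy_efficiency_bigo_inverse:
  "energy_efficiency f g SNR \<delta> r \<in> O(\<lambda>n. 1 / real n)"
proof -
  have "(\<lambda>n. (2 * real n + 1) / (real n * (real n + 1))) \<in> O(\<lambda>n. 1 / real n)"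
  \<comment> \<open>The constant 2 comes from \<open>2n+1 \<le> 2(n+1)\<close>, after which
    \<open>n+1\<close> cancels. Division by zero gives 0 on both sides at \<open>n = 0\<close>, so
    the bound holds for every \<open>n\<close>.\<close>
  proof (rule bigoI[where c = 2], intro always_eventually allI)
    fix n
    show "norm ((2 * real n + 1) / (real n * (real n + 1))) \<le> 2 * norm (1 / real n)"
    proof (cases "n = 0")
      case False
      have "(2 * real n + 1) / (real n * (real n + 1))
          \<le> (2 * (real n + 1)) / (real n * (real n + 1))"
        by (intro divide_right_mono) simp_all
      also have "\<dots> = 2 / real n"
        by (rule nonzero_mult_divide_mult_cancel_right) linarith
      finally show ?thesis by simp
    qed simp
  qed
  then have "(\<lambda>n. information_at_spacing f g SNR r / (2 * r powr \<delta>)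
      * ((2 * real n + 1) / (real n * (real n + 1)))) \<in> O(\<lambda>n. 1 * (1 / real n))"
    by (intro landau_o.big.mult bigo_const)
  then show ?thesis
    unfolding energy_efficiency_eq[abs_def] mult_1 .
qed

theorem theorem2:
  fixes f g :: "real \<Rightarrow> real" and SNR \<delta> r :: real
  assumes "SNR > 0" and "r > 0" and "\<delta> \<ge> 2"
    and "\<And>x. x > 0 \<Longrightarrow> 0 < f x \<and> f x \<le> 1"
    and "antimono_on {0<..} f"
    and "g \<in> {0..1} \<rightarrow> {0..1/4}"
    and "mono_on {0..1} g" and "g 0 = 0" and "g 1 = 1/4"
  shows "(\<lambda>n. energy_efficiency f g SNR \<delta> r n) \<longlonglongrightarrow> 0
    \<and> (\<lambda>n. energy_efficiency f g SNR \<delta> r n) \<in> O(\<lambda>n. covered_area r n powr (- (1/2)))"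
proof
  show "(\<lambda>n. energy_efficiency f g SNR \<delta> r n) \<longlonglongrightarrow> 0"
  proof -
    have "(\<lambda>n. 1 / real n) \<in> o(\<lambda>_. 1)"
      by (rule smalloI_tendsto) (use lim_1_over_n in simp_all)
    with energy_efficiency_bigo_inverse
    have "energy_efficiency f g SNR \<delta> r \<in> o(\<lambda>_. 1)"
      by (rule landau_o.big_small_trans)
    then show ?thesis by (auto dest: smalloD_tendsto)
  qed
  have area: "(\<lambda>n. covered_area r n powr (- (1/2))) = (\<lambda>n. 1 / (2 * r) * (1 / real n))"
    using \<open>r > 0\<close> by (simp add: covered_area_powr_neg_half mult_ac)
  have nonzero: "1 / (2 * r) \<noteq> 0"
    using \<open>r > 0\<close> by simp
  show "(\<lambda>n. energy_efficiency f g SNR \<delta> r n) \<in> O(\<lambda>n. covered_area r n powr (- (1/2)))"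
    \<comment> \<open>The factor \<open>1/(2r)\<close> is a nonzero constant in \<open>n\<close>, so
      it leaves the O-class unchanged.\<close>
    unfolding area landau_o.big.cmult[OF nonzero]
    by (intro energy_efficiency_bigo_inverse)
qed

end
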